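(* Let $\mathcal{F}$ be a family of nonempty compact connected sets in $\mathbb{R}^2$ such that every three sets in $\mathcal{F}$ form a tight triple. Then the line-piercing number of $\mathcal{F}$ is at most $3$; that is, there are three lines in the plane whose union intersects every set in $\mathcal{F}$.
   Context: Three compact connected sets $A,B,C$ in the plane form a tight triple if $\operatorname{conv}(A\cup B)\cap\operatorname{conv}(A\cup C)\cap\operatorname{conv}(B\cup C)\neq\emptyset$, where $\operatorname{conv}$ denotes the convex hull. The line-piercing number of a family $\mathcal{F}$ of sets in the plane is the minimum $k$ such that there are $k$ lines whose union intersects every set in $\mathcal{F}$. The family is not assumed to be finite. *)

theory Defs
  imports "HOL-Analysis.Analysis" "HOL-Library.Extended_Nat"
begin

(* Compactness and connectedness of the three sets are left to the user of the notion. *)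
definition tight_triple :: "(real^2) set \<Rightarrow> (real^2) set \<Rightarrow> (real^2) set \<Rightarrow> bool" where
  "tight_triple A B C \<longleftrightarrow>
     convex hull (A \<union> B) \<inter> convex hull (A \<union> C) \<inter> convex hull (B \<union> C) \<noteq> {}"

definition is_line :: "(real^2) set \<Rightarrow> bool" where
  "is_line l \<longleftrightarrow> affine l \<and> aff_dim l = 1"

definition pierced_by_lines :: "nat \<Rightarrow> (real^2) set set \<Rightarrow> bool" where
  "pierced_by_lines k \<F> \<longleftrightarrow>
     (\<exists>\<L>. finite \<L> \<and> card \<L> = k \<and> (\<forall>l\<in>\<L>. is_line l) \<and> (\<forall>A\<in>\<F>. A \<inter> \<Union>\<L> \<noteq> {}))"

(* The infimum is a minimum whenever it is finite, and it is infinity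
   when no finite number of lines suffices. *)
definition line_piercing_number :: "(real^2) set set \<Rightarrow> enat" where
  "line_piercing_number \<F> = Inf {enat k |k. pierced_by_lines k \<F>}"

end

theory Submission
  imports Defs
begin

text \<open>
  For a finite family inside the disc of radius R, a point x of the five-dimensional simplex
  cuts the circle into six arcs, consecutive arc lengths being proportional to the coordinates of x;
  the three chords joining opposite division points span three lines. If they miss a member F of
  the family, then F, being connected, lies in one of the six wedges, the k-th wedge being the
  set between the two lines through the end points of the k-th arc. A wedge whose arc is degenerate
  contains no point of the disc, so if no choice of x works, the KKM theorem yields an x for which
  each of the six wedges contains a member. Applying tightness to the odd and to the even wedges
  gives two points that lie on opposite sides of each of the three lines, in the sign patterns
  (+,-,+) and (-,+,-); this is impossible, because the middle normal vector is a positive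
  combination of the outer two. Compactness of the set of triples of projective lines extends the
  result to infinite families; a line at infinity meets no member and may be replaced by any line.
\<close>

section \<open>Projections of compact sets\<close>

text \<open>The sublevel set of \<open>h\<close> in the compact product is compact, and so is its
  image under \<open>fst\<close>. It yields both the openness of the wedge conditions and the
  closedness of the sets of line triples meeting a member.\<close>

lemma compact_projection_le_zero:
  fixes h :: "'a::{t2_space} \<times> 'b::{t2_space} \<Rightarrow> real"
  assumes "compact S" "compact K" "continuous_on (S \<times> K) h"
  shows "compact {x \<in> S. \<exists>y\<in>K. h (x, y) \<le> 0}"
proof -
  have "compact ((S \<times> K) \<inter> h -` {..0})"
    using assms closedin_compact[OF compact_Times continuous_closedin_preimage] by blast
  moreover have "(S \<times> K) \<inter> h -` {..0} = {z \<in> S \<times> K. h z \<le> 0}" by auto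
  ultimately have "compact {z \<in> S \<times> K. h z \<le> 0}" by simp
  then have "compact (fst ` {z \<in> S \<times> K. h z \<le> 0})"
    by (intro compact_continuous_image continuous_on_fst continuous_on_id)
  moreover have "fst ` {z \<in> S \<times> K. h z \<le> 0} = {x \<in> S. \<exists>y\<in>K. h (x, y) \<le> 0}"
    by force
  ultimately show ?thesis by simp
qed

section \<open>The standard simplex and the KKM theorem\<close>

definition unit_simplex :: "(real^'n) set" where
  "unit_simplex = {x. (\<forall>i. 0 \<le> x $ i) \<and> (\<Sum>i\<in>UNIV. x $ i) = 1}"

lemma compact_unit_simplex: "compact (unit_simplex :: (real^'n) set)"
proof -
  have "unit_simplex = (\<Inter>i. {x :: real^'n. 0 \<le> x $ i}) \<inter> {x. (\<Sum>i\<in>UNIV. x $ i) = 1}"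
    by (auto simp: unit_simplex_def)
  moreover have "closed ((\<Inter>i. {x :: real^'n. 0 \<le> x $ i}) \<inter> {x. (\<Sum>i\<in>UNIV. x $ i) = 1})"
    by (intro closed_Int closed_INT ballI closed_Collect_le closed_Collect_eq continuous_intros)
  moreover have "norm x \<le> 1" if "x \<in> unit_simplex" for x :: "real^'n"
    using norm_le_l1_cart[of x] that by (simp add: unit_simplex_def)
  ultimately show ?thesis
    by (metis boundedI compact_eq_bounded_closed)
qed

lemma convex_unit_simplex: "convex (unit_simplex :: (real^'n) set)"
  by (auto simp: convex_def unit_simplex_def sum.distrib simp flip: sum_distrib_left)

lemma unit_simplex_nonempty: "(unit_simplex :: (real^'n) set) \<noteq> {}"
proof -
  have "(\<chi> i. 1 / real CARD('n)) \<in> (unit_simplex :: (real^'n) set)"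
    by (simp add: unit_simplex_def)
  then show ?thesis by blast
qed

text \<open>By \<open>pos\<close>, a point of a face can only lie in sets \<open>A i\<close> with
  \<open>i\<close> a vertex of that face; with \<open>cover\<close> this is the KKM boundary
  condition. A missing common point makes a self-map of the simplex well defined, and its Brouwer
  fixed point is contradictory.\<close>

theorem KKM_open:
  fixes A :: "'n::finite \<Rightarrow> (real^'n) set"
  assumes op: "\<And>i. openin (top_of_set unit_simplex) (A i)"
    and cover: "unit_simplex \<subseteq> (\<Union>i. A i)"
    and pos: "\<And>i x. x \<in> A i \<Longrightarrow> 0 < x $ i"
  obtains x where "x \<in> unit_simplex" "\<And>i. x \<in> A i"
proof (rule ccontr)
  assume "\<not> thesis"
  with that have miss: "\<exists>j. x \<notin> A j" if "x \<in> unit_simplex" for x using \<open>x \<in> unit_simplex\<close> by blast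
  let ?S = "unit_simplex :: (real^'n) set" and ?n = "real CARD('n)"
  \<comment> \<open>0 lies outside the simplex; it only keeps C i nonempty, as infdist to the empty set is 0\<close>
  define C where "C i = insert 0 (?S - A i)" for i
  define \<phi> where "\<phi> i x = infdist x (C i)" for i x
  define M where "M x = (\<Sum>i\<in>UNIV. \<phi> i x)" for x
  \<comment> \<open>The map normalising u pushes x away from the sets A i containing it most deeply: at a
    fixed point, u i x = 0 would give x $ i = 0, hence \<phi> i x = 0.\<close>
  define u where "u i x = max 0 (M x - ?n * \<phi> i x)" for i x
  have clC: "closed (C i)" for i
  proof -
    have "closedin (top_of_set ?S) (?S - A i)"
      using op by (rule closedin_diff[OF closedin_self])
    then show ?thesis
      unfolding C_def using compact_unit_simplex closedin_closed_trans compact_imp_closed closed_insert by blast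
  qed
  have \<phi>0: "\<phi> i x \<ge> 0" for i x by (simp add: \<phi>_def infdist_nonneg)
  have M0: "M x \<ge> 0" for x by (simp add: M_def sum_nonneg \<phi>0)
  have \<phi>_pos: "0 < \<phi> i x \<longleftrightarrow> x \<in> A i" if x: "x \<in> ?S" for i x
  proof -
    have "x \<noteq> 0" using x by (auto simp: unit_simplex_def)
    moreover have "\<phi> i x = 0 \<longleftrightarrow> x \<in> C i"
      using in_closed_iff_infdist_zero[OF clC, of i x] by (simp add: \<phi>_def C_def)
    ultimately show ?thesis using x \<phi>0[of i x] by (auto simp: C_def)
  qed
  have u_pos: "0 < (\<Sum>i\<in>UNIV. u i x)" if x: "x \<in> ?S" for x
  proof -
    obtain j where "x \<notin> A j" using miss x by blast
    then have "\<phi> j x = 0" using \<phi>_pos[OF x, of j] \<phi>0[of j x] by simp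
    moreover obtain i where "x \<in> A i" using cover x by blast
    then have "0 < \<phi> i x" using \<phi>_pos[OF x] by simp
    then have "0 < M x" unfolding M_def by (intro sum_pos2[of _ i]) (auto simp: \<phi>0)
    ultimately have "0 < u j x" by (simp add: u_def)
    then show ?thesis by (intro sum_pos2[of _ j]) (auto simp: u_def)
  qed
  define f where "f x = (\<chi> i. u i x / (\<Sum>i\<in>UNIV. u i x))" for x
  have "continuous_on ?S f"
    unfolding f_def u_def M_def \<phi>_def
    using u_pos unfolding u_def M_def \<phi>_def
    by (intro continuous_intros) fastforce
  moreover have "f \<in> ?S \<rightarrow> ?S"
    using u_pos by (force simp: f_def unit_simplex_def u_def simp flip: sum_divide_distrib)
  ultimately obtain x where x: "x \<in> ?S" and fx: "f x = x"
    using brouwer[OF compact_unit_simplex convex_unit_simplex unit_simplex_nonempty] by metis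
  have le: "?n * \<phi> i x \<le> M x" for i
  proof (rule ccontr)
    assume *: "\<not> ?n * \<phi> i x \<le> M x"
    then have "u i x = 0" by (simp add: u_def)
    then have "x $ i = 0" using arg_cong[OF fx, of "\<lambda>y. y $ i"] by (simp add: f_def)
    then have "\<phi> i x = 0" using pos[of x i] \<phi>_pos[OF x, of i] \<phi>0[of i x] by force
    with * M0[of x] show False by simp
  qed
  obtain j where "x \<notin> A j" using miss x by blast
  then have j: "\<phi> j x = 0" using \<phi>_pos[OF x, of j] \<phi>0[of j x] by simp
  obtain i where "x \<in> A i" using cover x by blast
  then have "0 < \<phi> i x" using \<phi>_pos[OF x] by simp
  then have "0 < M x" unfolding M_def by (intro sum_pos2[of _ i]) (auto simp: \<phi>0)
  then have "(\<Sum>i\<in>UNIV. ?n * \<phi> i x) < (\<Sum>i\<in>(UNIV::'n set). M x)"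
    using le j by (intro sum_strict_mono_ex1) (auto intro!: exI[of _ j])
  then show False by (simp add: M_def flip: sum_distrib_left)
qed

section \<open>Chords of a circle and half-planes\<close>

text \<open>
  The line through the points at angles a and b of the circle of radius R is the zero set of
  chord R a b. For b = a and b = a + 2 * pi it is the tangent, so that the line depends
  continuously on a and b. The open arc from a to b is on the positive side.
\<close>

definition chord :: "real \<Rightarrow> real \<Rightarrow> real \<Rightarrow> real^2 \<Rightarrow> real" where
  "chord R a b p = p $ 1 * cos ((a + b) / 2) + p $ 2 * sin ((a + b) / 2) - R * cos ((b - a) / 2)"

lemma chord_swap: "chord R b (a + 2 * pi) p = - chord R a b p"
proof -
  have *: "(b + (a + 2 * pi)) / 2 = (a + b) / 2 + pi" "(a + 2 * pi - b) / 2 = pi - (b - a) / 2"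
    by (simp_all add: field_simps)
  show ?thesis unfolding chord_def * by simp
qed

text \<open>Advancing the second end point enlarges the part of the disc on the positive side of the
  chord. This is what rules out members in the wedge of a degenerate arc.\<close>

lemma chord_mono:
  assumes p: "norm p \<le> R" and ab: "a \<le> b" "b \<le> b'" "b' \<le> a + 2 * pi"
    and pos: "0 < chord R a b p"
  shows "0 \<le> chord R a b' p"
proof -
  \<comment> \<open>Coordinates of \<open>p\<close> along the radius at angle \<open>a\<close> and
    along the tangent there.\<close>
  define u v where "u = p $ 1 * cos a + p $ 2 * sin a" and "v = p $ 2 * cos a - p $ 1 * sin a"
  have chord_eq: "chord R a (a + 2 * \<beta>) p = v * sin \<beta> - (R - u) * cos \<beta>" for \<beta>
  proof -
    have *: "(a + (a + 2 * \<beta>)) / 2 = a + \<beta>" "(a + 2 * \<beta> - a) / 2 = \<beta>" by simp_all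
    show ?thesis unfolding chord_def u_def v_def * cos_add sin_add by (simp add: algebra_simps)
  qed
  have "u = p \<bullet> vector [cos a, sin a]"
    by (simp add: u_def inner_vec_def sum_2)
  also have "\<dots> \<le> norm p * norm (vector [cos a, sin a] :: real^2)" by (rule norm_cauchy_schwarz)
  also have "norm (vector [cos a, sin a] :: real^2) = 1"
    by (simp add: norm_vec_def L2_set_def sum_2)
  finally have u: "0 \<le> R - u" using p by simp
  define \<beta> \<beta>' where "\<beta> = (b - a) / 2" and "\<beta>' = (b' - a) / 2"
  have ends: "a + 2 * \<beta> = b" "a + 2 * \<beta>' = b'" by (simp_all add: \<beta>_def \<beta>'_def field_simps)
  have \<beta>: "0 \<le> \<beta>" "\<beta> \<le> \<beta>'" "\<beta>' \<le> pi" using ab by (auto simp: \<beta>_def \<beta>'_def)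
  have *: "0 < v * sin \<beta> - (R - u) * cos \<beta>"
    using pos chord_eq[of \<beta>] ends by simp
  have "0 \<le> v * sin \<beta>' - (R - u) * cos \<beta>'"
  proof (cases "\<beta> = pi")
    case True then have "\<beta>' = \<beta>" using \<beta> by simp
    then show ?thesis using * by simp
  next
    case False
    have "\<beta> \<noteq> 0" using * u by auto
    then have s: "0 < sin \<beta>" using False \<beta> by (intro sin_gt_zero) auto
    have "0 \<le> sin \<beta>'" using \<beta> by (intro sin_ge_zero) auto
    \<comment> \<open>With g(t) = v sin t - (R - u) cos t, the identity behind the step is
      g(\<beta>') sin \<beta> = g(\<beta>) sin \<beta>' + (R - u) sin (\<beta>' - \<beta>).\<close>
    then have "0 \<le> (v * sin \<beta> - (R - u) * cos \<beta>) * sin \<beta>'" using * by simp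
    moreover have "0 \<le> (R - u) * sin (\<beta>' - \<beta>)"
      using u \<beta> by (intro mult_nonneg_nonneg sin_ge_zero) auto
    ultimately have "0 \<le> (v * sin \<beta>' - (R - u) * cos \<beta>') * sin \<beta>"
      unfolding sin_diff by (simp add: algebra_simps)
    then show ?thesis using s by (simp add: zero_le_mult_iff)
  qed
  then show ?thesis using chord_eq[of \<beta>'] ends by simp
qed

text \<open>With \<open>s1\<close>, \<open>s2\<close>, \<open>s3\<close> as below, the unit normals
  satisfy s1 n1 + s3 n3 = s2 n2 with positive coefficients. Hence \<open>p\<close> forces s1 c1 + s3
  c3 < s2 c2, and \<open>q\<close> forces the reverse.\<close>

lemma alternating_cells_not_both:
  fixes p q :: "real^2"
  assumes \<theta>: "\<theta>1 < \<theta>2" "\<theta>2 < \<theta>3" "\<theta>3 < \<theta>1 + pi"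
    and p: "p $ 1 * cos \<theta>1 + p $ 2 * sin \<theta>1 > c1" "p $ 1 * cos \<theta>2 + p $ 2 * sin \<theta>2 < c2"
      "p $ 1 * cos \<theta>3 + p $ 2 * sin \<theta>3 > c3"
    and q: "q $ 1 * cos \<theta>1 + q $ 2 * sin \<theta>1 < c1" "q $ 1 * cos \<theta>2 + q $ 2 * sin \<theta>2 > c2"
      "q $ 1 * cos \<theta>3 + q $ 2 * sin \<theta>3 < c3"
  shows False
proof -
  define s1 s2 s3 where "s1 = sin (\<theta>3 - \<theta>2)" and "s2 = sin (\<theta>3 - \<theta>1)" and "s3 = sin (\<theta>2 - \<theta>1)"
  have s: "0 < s1" "0 < s2" "0 < s3"
    using \<theta> unfolding s1_def s2_def s3_def by (auto intro!: sin_gt_zero)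
  define L where "L r \<theta> = r $ 1 * cos \<theta> + r $ 2 * sin \<theta>" for r :: "real^2" and \<theta>
  have dep: "s1 * L r \<theta>1 + s3 * L r \<theta>3 = s2 * L r \<theta>2" for r
  proof -
    have "s1 * cos \<theta>1 + s3 * cos \<theta>3 = s2 * cos \<theta>2 * (sin \<theta>1 ^ 2 + cos \<theta>1 ^ 2)"
      unfolding s1_def s2_def s3_def sin_diff
      using sin_cos_squared_add[of \<theta>1] sin_cos_squared_add[of \<theta>3] by algebra
    moreover have "s1 * sin \<theta>1 + s3 * sin \<theta>3 = s2 * sin \<theta>2 * (sin \<theta>1 ^ 2 + cos \<theta>1 ^ 2)"
      unfolding s1_def s2_def s3_def sin_diff
      using sin_cos_squared_add[of \<theta>1] sin_cos_squared_add[of \<theta>3] by algebra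
    ultimately have "s1 * cos \<theta>1 + s3 * cos \<theta>3 = s2 * cos \<theta>2"
      "s1 * sin \<theta>1 + s3 * sin \<theta>3 = s2 * sin \<theta>2" by simp_all
    then show ?thesis unfolding L_def by algebra
  qed
  have "s1 * c1 < s1 * L p \<theta>1" "s2 * L p \<theta>2 < s2 * c2" "s3 * c3 < s3 * L p \<theta>3"
    "s1 * L q \<theta>1 < s1 * c1" "s2 * c2 < s2 * L q \<theta>2" "s3 * L q \<theta>3 < s3 * c3"
    using p q s by (simp_all add: L_def)
  with dep[of p] dep[of q] show False by linarith
qed

section \<open>Tight triples\<close>

lemma tight_triple_meets_convex:
  assumes "tight_triple A B C" "convex U" "convex V" "convex W"
    "A \<union> B \<subseteq> U" "A \<union> C \<subseteq> V" "B \<union> C \<subseteq> W"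
  obtains p where "p \<in> U" "p \<in> V" "p \<in> W"
  using assms hull_minimal[of _ _ convex] unfolding tight_triple_def by blast

text \<open>A point of the repeated set lies in all three unions. This matters because one member
  may serve for two wedges of the same parity.\<close>

lemma tight_triple_if_eq:
  assumes "A \<noteq> {}" "B \<noteq> {}" "C \<noteq> {}" "A = B \<or> A = C \<or> B = C"
  shows "tight_triple A B C"
proof -
  obtain a b c where "a \<in> A" "b \<in> B" "c \<in> C" using assms by blast
  then have "\<exists>p. p \<in> convex hull (A \<union> B) \<inter> convex hull (A \<union> C) \<inter> convex hull (B \<union> C)"
    using assms(4) by (metis IntI Un_iff hull_inc)
  then show ?thesis unfolding tight_triple_def by blast
qed

section \<open>Cyclic division of the circle into six arcs\<close>

lemma inj_on_of_nat_6: "inj_on (of_nat :: nat \<Rightarrow> 6) {..<6}"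
proof (rule linorder_inj_onI)
  fix i j :: nat
  assume ij: "i < j" "i \<in> {..<6}" "j \<in> {..<6}"
  show "(of_nat i :: 6) \<noteq> of_nat j"
  proof
    assume "(of_nat i :: 6) = of_nat j"
    then have "(of_nat (j - i) :: 6) = 0" using ij by (simp add: of_nat_diff)
    then have "6 dvd j - i" by (simp only: of_nat_eq_0_iff_char_dvd) simp
    then show False using ij by (auto dest: dvd_imp_le)
  qed
qed auto

lemma UNIV_6: "(UNIV :: 6 set) = of_nat ` {..<6}"
proof -
  have "card ((of_nat :: nat \<Rightarrow> 6) ` {..<6}) = CARD(6)" by (simp add: card_image inj_on_of_nat_6)
  then show ?thesis by (metis card_subset_eq finite_class.finite_UNIV subset_UNIV)
qed

text \<open>The index j is reduced modulo 6 by of_nat, so the arcs are continued periodically.\<close>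

definition arc_end :: "real^6 \<Rightarrow> nat \<Rightarrow> real" where
  "arc_end x k = 2 * pi * (\<Sum>j<k. x $ of_nat j)"

lemma arc_end_Suc: "arc_end x (Suc k) = arc_end x k + 2 * pi * x $ of_nat k"
  by (simp add: arc_end_def algebra_simps)

lemma arc_end_periodic:
  assumes "x \<in> unit_simplex"
  shows "arc_end x (k + 6) = arc_end x k + 2 * pi"
proof (induction k)
  case 0
  have "(\<Sum>j<6. x $ of_nat j) = (\<Sum>i\<in>UNIV. x $ i)"
    unfolding UNIV_6 by (simp add: sum.reindex[OF inj_on_of_nat_6])
  then show ?case using assms by (simp add: arc_end_def unit_simplex_def)
next
  case (Suc k)
  have "arc_end x (Suc k + 6) = arc_end x (k + 6) + 2 * pi * x $ of_nat (k + 6)"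
    using arc_end_Suc[of x "k + 6"] by simp
  moreover have "(6 :: 6) = 0" by simp
  ultimately show ?case using Suc by (simp add: arc_end_Suc)
qed

lemma arc_end_mono:
  assumes "x \<in> unit_simplex" "j \<le> k"
  shows "arc_end x j \<le> arc_end x k"
  by (rule lift_Suc_mono_le[OF _ assms(2)]) (use assms(1) in \<open>simp add: arc_end_Suc unit_simplex_def\<close>)

lemma arc_end_strict_mono:
  assumes "\<And>i. 0 < x $ i" "j < k"
  shows "arc_end x j < arc_end x k"
  by (rule lift_Suc_mono_less[OF _ assms(2)]) (simp add: arc_end_Suc assms(1))

section \<open>Opposite chords and the wedges between them\<close>

definition arc_chord :: "real \<Rightarrow> real^6 \<Rightarrow> nat \<Rightarrow> real^2 \<Rightarrow> real" where
  "arc_chord R x k = chord R (arc_end x k) (arc_end x (k + 3))"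

text \<open>Three steps on, the same two division points are joined in the opposite order, which
  exchanges the sides. So there are only three lines, those with \<open>k < 3\<close>.\<close>

lemma arc_chord_antiperiodic:
  assumes "x \<in> unit_simplex"
  shows "arc_chord R x (k + 3) p = - arc_chord R x k p"
  using arc_end_periodic[OF assms, of k] chord_swap
  by (simp add: arc_chord_def add.assoc)

lemma continuous_on_arc_chord:
  "continuous_on T (\<lambda>(x, p). arc_chord R x k p)"
  unfolding arc_chord_def chord_def arc_end_def case_prod_beta
  by (intro continuous_intros) auto

lemma connected_nonzero_sign:
  fixes g :: "'a::topological_space \<Rightarrow> real"
  assumes "connected F" "continuous_on F g" "\<And>p. p \<in> F \<Longrightarrow> g p \<noteq> 0"
  shows "(\<forall>p\<in>F. 0 < g p) \<or> (\<forall>p\<in>F. g p < 0)"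
proof (rule ccontr)
  assume "\<not> ?thesis"
  then obtain p q where "p \<in> F" "g p \<le> 0" "q \<in> F" "0 \<le> g q" by (meson not_less)
  moreover have "is_interval (g ` F)"
    using assms connected_continuous_image is_interval_connected_1 by blast
  ultimately have "0 \<in> g ` F" unfolding is_interval_1 by blast
  then show False using assms(3) by auto
qed

text \<open>The signs select the wedge at the arc from \<open>arc_end x k\<close> to
  \<open>arc_end x (Suc k)\<close>: this arc is on the positive side of chord \<open>k\<close> and
  on the negative side of chord \<open>Suc k\<close>.\<close>

definition wedge_set :: "real \<Rightarrow> (real^2) set set \<Rightarrow> nat \<Rightarrow> (real^6) set" where
  "wedge_set R \<F> k = {x \<in> unit_simplex.
     \<exists>F\<in>\<F>. \<forall>p\<in>F. 0 < arc_chord R x k p \<and> arc_chord R x (Suc k) p < 0}"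

lemma openin_wedge_set:
  assumes "\<And>F. F \<in> \<F> \<Longrightarrow> compact F"
  shows "openin (top_of_set unit_simplex) (wedge_set R \<F> k)"
proof -
  define h where "h = (\<lambda>(x, p). min (arc_chord R x k p) (- arc_chord R x (Suc k) p))"
  have op: "openin (top_of_set unit_simplex) (unit_simplex - {x \<in> unit_simplex. \<exists>p\<in>F. h (x, p) \<le> 0})"
    if "F \<in> \<F>" for F
  proof -
    have "continuous_on T h" for T
      unfolding h_def case_prod_beta
      using continuous_on_arc_chord[unfolded case_prod_beta] by (intro continuous_intros) auto
    then have "compact {x \<in> unit_simplex. \<exists>p\<in>F. h (x, p) \<le> 0}"
      using assms that compact_unit_simplex by (intro compact_projection_le_zero) auto
    then have "closedin (top_of_set unit_simplex) {x \<in> unit_simplex. \<exists>p\<in>F. h (x, p) \<le> 0}"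
      by (intro closed_subset compact_imp_closed) auto
    then show ?thesis by (intro openin_diff) auto
  qed
  moreover have "wedge_set R \<F> k =
    (\<Union>F\<in>\<F>. unit_simplex - {x \<in> unit_simplex. \<exists>p\<in>F. h (x, p) \<le> 0})"
    by (force simp: wedge_set_def h_def not_le)
  ultimately show ?thesis by (metis (no_types, lifting) imageE openin_Union)
qed

text \<open>If the \<open>k\<close>-th arc degenerates, chords \<open>k\<close> and
  \<open>Suc k\<close> start at the same point and the second one ends later, so by
  \<open>chord_mono\<close> no point of the disc is positive for the first and negative for the
  second.\<close>

lemma wedge_set_pos:
  assumes "\<And>F. F \<in> \<F> \<Longrightarrow> F \<noteq> {} \<and> F \<subseteq> cball 0 R" and x: "x \<in> wedge_set R \<F> k"
  shows "0 < x $ of_nat k"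
proof (rule ccontr)
  assume "\<not> ?thesis"
  moreover have S: "x \<in> unit_simplex" using x by (simp add: wedge_set_def)
  ultimately have "x $ of_nat k = 0" by (simp add: unit_simplex_def order_antisym not_less)
  then have eq: "arc_end x (Suc k) = arc_end x k" by (simp add: arc_end_Suc)
  obtain F where F: "F \<in> \<F>" "\<forall>p\<in>F. 0 < arc_chord R x k p \<and> arc_chord R x (Suc k) p < 0"
    using x by (auto simp: wedge_set_def)
  obtain p where p: "p \<in> F" using assms F by blast
  have "0 \<le> chord R (arc_end x k) (arc_end x (k + 4)) p"
  proof (rule chord_mono)
    show "norm p \<le> R" using assms F p by force
    show "0 < chord R (arc_end x k) (arc_end x (k + 3)) p" using F p by (simp add: arc_chord_def)
    show "arc_end x (k + 4) \<le> arc_end x k + 2 * pi"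
      using arc_end_mono[OF S, of "k + 4" "k + 6"] by (simp add: arc_end_periodic[OF S])
  qed (auto intro: arc_end_mono[OF S])
  then have "0 \<le> arc_chord R x (Suc k) p" by (simp add: arc_chord_def eq add.commute)
  then show False using F p by force
qed

lemma arc_chord_inner:
  obtains n c where "norm n = 1" "\<And>p. arc_chord R x k p = n \<bullet> p - c"
proof
  define a where "a = (arc_end x k + arc_end x (k + 3)) / 2"
  show "norm (vector [cos a, sin a] :: real^2) = 1"
    by (simp add: norm_vec_def L2_set_def sum_2)
  show "arc_chord R x k p =
      vector [cos a, sin a] \<bullet> p - R * cos ((arc_end x (k + 3) - arc_end x k) / 2)" for p
    by (simp add: arc_chord_def chord_def inner_vec_def sum_2 flip: a_def)
qed

lemma convex_arc_halfplanes:
  "convex {p. 0 < arc_chord R x k p}" "convex {p. arc_chord R x k p < 0}"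
proof -
  obtain n c where *: "\<And>p. arc_chord R x k p = n \<bullet> p - c" using arc_chord_inner by metis
  have "{p. 0 < n \<bullet> p - c} = {p. n \<bullet> p > c}" "{p. n \<bullet> p - c < 0} = {p. n \<bullet> p < c}" by auto
  then show "convex {p. 0 < arc_chord R x k p}" "convex {p. arc_chord R x k p < 0}"
    unfolding * by (simp_all add: convex_halfspace_gt convex_halfspace_lt)
qed

text \<open>Any two wedges of the same parity lie on a common side of one of the three lines.
  Tightness therefore gives one point in the three half-planes of the even wedges and another in the
  opposite three.\<close>

lemma wedge_sets_not_all:
  assumes ne: "\<And>F. F \<in> \<F> \<Longrightarrow> F \<noteq> {}"
    and tight: "\<And>A B C. A \<in> \<F> \<Longrightarrow> B \<in> \<F> \<Longrightarrow> C \<in> \<F> \<Longrightarrow> tight_triple A B C"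
    and pos: "\<And>i. 0 < x $ i"
    and all: "\<And>k. k < 6 \<Longrightarrow> x \<in> wedge_set R \<F> k"
  shows False
proof -
  have S: "x \<in> unit_simplex" using all[of 0] by (simp add: wedge_set_def)
  let ?G = "arc_chord R x"
  have G: "?G 3 p = - ?G 0 p" "?G 4 p = - ?G 1 p" "?G 5 p = - ?G 2 p" "?G 6 p = ?G 0 p" for p
    using arc_chord_antiperiodic[OF S, of R 0 p] arc_chord_antiperiodic[OF S, of R 1 p]
      arc_chord_antiperiodic[OF S, of R 2 p] arc_chord_antiperiodic[OF S, of R 3 p] by simp_all
  have "\<exists>F\<in>\<F>. \<forall>p\<in>F. 0 < ?G k p \<and> ?G (Suc k) p < 0" if "k < 6" for k
    using all[OF that] by (simp add: wedge_set_def)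
  then obtain F where F: "\<And>k. k < 6 \<Longrightarrow> F k \<in> \<F>"
    "\<And>k p. k < 6 \<Longrightarrow> p \<in> F k \<Longrightarrow> 0 < ?G k p \<and> ?G (Suc k) p < 0" by metis
  have signs: "p \<in> F 0 \<Longrightarrow> 0 < ?G 0 p \<and> ?G 1 p < 0" "p \<in> F 1 \<Longrightarrow> 0 < ?G 1 p \<and> ?G 2 p < 0"
    "p \<in> F 2 \<Longrightarrow> 0 < ?G 2 p \<and> 0 < ?G 0 p" "p \<in> F 3 \<Longrightarrow> ?G 0 p < 0 \<and> 0 < ?G 1 p"
    "p \<in> F 4 \<Longrightarrow> ?G 1 p < 0 \<and> 0 < ?G 2 p" "p \<in> F 5 \<Longrightarrow> ?G 2 p < 0 \<and> ?G 0 p < 0" for p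
    using F(2)[of 0 p] F(2)[of 1 p] F(2)[of 2 p] F(2)[of 3 p] F(2)[of 4 p] F(2)[of 5 p]
    by (auto simp: G numeral_2_eq_2[symmetric])
  have "tight_triple (F 0) (F 2) (F 4)" "tight_triple (F 1) (F 3) (F 5)"
    using F(1) by (auto intro!: tight)
  obtain p where p: "0 < ?G 0 p" "?G 1 p < 0" "0 < ?G 2 p"
  proof (rule tight_triple_meets_convex[OF \<open>tight_triple (F 0) (F 2) (F 4)\<close> convex_arc_halfplanes(1)[of R x 0]
        convex_arc_halfplanes(2)[of R x 1] convex_arc_halfplanes(1)[of R x 2]])
  qed (use signs in auto)
  obtain q where q: "0 < ?G 1 q" "?G 2 q < 0" "?G 0 q < 0"
  proof (rule tight_triple_meets_convex[OF \<open>tight_triple (F 1) (F 3) (F 5)\<close> convex_arc_halfplanes(1)[of R x 1]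
        convex_arc_halfplanes(2)[of R x 2] convex_arc_halfplanes(2)[of R x 0]])
  qed (use signs in auto)
  define \<theta> where "\<theta> k = (arc_end x k + arc_end x (k + 3)) / 2" for k
  define c where "c k = R * cos ((arc_end x (k + 3) - arc_end x k) / 2)" for k
  have G_eq: "?G k r = r $ 1 * cos (\<theta> k) + r $ 2 * sin (\<theta> k) - c k" for k r
    by (simp add: arc_chord_def chord_def \<theta>_def c_def)
  have lt: "arc_end x j < arc_end x k" if "j < k" for j k
    using arc_end_strict_mono pos that by blast
  show False
  proof (rule alternating_cells_not_both)
    show "\<theta> 0 < \<theta> 1" "\<theta> 1 < \<theta> 2"
      using lt[of 0 1] lt[of 1 2] lt[of 3 4] lt[of 4 5] by (simp_all add: \<theta>_def)
    \<comment> \<open>Division points 2 and 5 strictly precede 3 and 6, and point 6 is point 0 after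
      a full turn.\<close>
    show "\<theta> 2 < \<theta> 0 + pi"
      using lt[of 2 3] lt[of 5 6] arc_end_periodic[OF S, of 0] by (simp add: \<theta>_def field_simps)
  qed (use p q in \<open>simp_all add: G_eq\<close>)
qed

section \<open>Piercing a family inside a disc\<close>

lemma bounded_family_pierced:
  assumes F: "\<And>F. F \<in> \<F> \<Longrightarrow> F \<noteq> {} \<and> compact F \<and> connected F \<and> F \<subseteq> cball 0 R"
    and tight: "\<And>A B C. A \<in> \<F> \<Longrightarrow> B \<in> \<F> \<Longrightarrow> C \<in> \<F> \<Longrightarrow> tight_triple A B C"
  shows "\<exists>x. \<forall>F\<in>\<F>. \<exists>p\<in>F. \<exists>k<3. arc_chord R x k p = 0"
proof (rule ccontr)
  assume "\<not> ?thesis"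
  then have no: "\<exists>F\<in>\<F>. \<forall>p\<in>F. \<forall>k<3. arc_chord R x k p \<noteq> 0" for x by simp
  have cover: "\<exists>k<6. x \<in> wedge_set R \<F> k" if S: "x \<in> unit_simplex" for x
  proof -
    let ?G = "arc_chord R x"
    have G: "?G 3 p = - ?G 0 p" "?G 4 p = - ?G 1 p" "?G 5 p = - ?G 2 p" "?G 6 p = ?G 0 p" for p
      using arc_chord_antiperiodic[OF S, of R 0 p] arc_chord_antiperiodic[OF S, of R 1 p]
        arc_chord_antiperiodic[OF S, of R 2 p] arc_chord_antiperiodic[OF S, of R 3 p] by simp_all
    obtain C where C: "C \<in> \<F>" "\<forall>p\<in>C. \<forall>k<3. ?G k p \<noteq> 0" using no by blast
    define P N where "P k \<longleftrightarrow> (\<forall>p\<in>C. 0 < ?G k p)" and "N k \<longleftrightarrow> (\<forall>p\<in>C. ?G k p < 0)" for k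
    have sgn: "P k \<or> N k" if "k < 3" for k
      unfolding P_def N_def
    proof (rule connected_nonzero_sign)
      show "continuous_on C (?G k)" unfolding arc_chord_def chord_def by (intro continuous_intros) auto
    qed (use C F that in auto)
    have W: "x \<in> wedge_set R \<F> k" if "P k" "N (Suc k)" for k
      using that C S by (auto simp: wedge_set_def P_def N_def)
    have PN: "P 3 = N 0" "P 4 = N 1" "P 5 = N 2" "N 3 = P 0" "N 4 = P 1" "N 5 = P 2" "N 6 = N 0"
      by (simp_all add: P_def N_def G)
    \<comment> \<open>The signs of \<open>C\<close> for six consecutive chords form a cyclic
      sequence that flips after three places. It is not constant, so somewhere a plus is followed by
      a minus, and \<open>C\<close> lies in that wedge.\<close>
    have "P 0 \<Longrightarrow> N 1 \<Longrightarrow> x \<in> wedge_set R \<F> 0" "P 1 \<Longrightarrow> N 2 \<Longrightarrow> x \<in> wedge_set R \<F> 1"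
      "P 2 \<Longrightarrow> P 0 \<Longrightarrow> x \<in> wedge_set R \<F> 2" "N 0 \<Longrightarrow> P 1 \<Longrightarrow> x \<in> wedge_set R \<F> 3"
      "N 1 \<Longrightarrow> P 2 \<Longrightarrow> x \<in> wedge_set R \<F> 4" "N 2 \<Longrightarrow> N 0 \<Longrightarrow> x \<in> wedge_set R \<F> 5"
      using W[of 0] W[of 1] W[of 2] W[of 3] W[of 4] W[of 5]
      by (simp_all add: PN flip: numeral_2_eq_2 One_nat_def)
    moreover have "P 0 \<or> N 0" "P 1 \<or> N 1" "P 2 \<or> N 2" using sgn by simp_all
    moreover have "(0::nat) < 6" "(1::nat) < 6" "(2::nat) < 6" "(3::nat) < 6" "(4::nat) < 6" "(5::nat) < 6" by auto
    ultimately show ?thesis by blast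
  qed
  \<comment> \<open>KKM indexes its sets by the coordinates, of type \<open>6\<close>;
    \<open>ix\<close> picks the representative below 6.\<close>
  define ix :: "6 \<Rightarrow> nat" where "ix = inv_into {..<6} of_nat"
  have ix: "of_nat (ix i) = i" for i
    unfolding ix_def by (rule f_inv_into_f) (simp flip: UNIV_6)
  have ix_of_nat: "ix (of_nat k) = k" if "k < 6" for k
    unfolding ix_def using that inj_on_of_nat_6 by (intro inv_into_f_f) auto
  obtain x where x: "\<And>i. x \<in> wedge_set R \<F> (ix i)"
  proof (rule KKM_open[of "\<lambda>i. wedge_set R \<F> (ix i)"])
    show "openin (top_of_set unit_simplex) (wedge_set R \<F> (ix i))" for i
      using F by (intro openin_wedge_set) blast
    show "unit_simplex \<subseteq> (\<Union>i. wedge_set R \<F> (ix i))"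
    proof
      fix x :: "real^6" assume "x \<in> unit_simplex"
      then obtain k where k: "k < 6" "x \<in> wedge_set R \<F> k" using cover by blast
      then have "x \<in> wedge_set R \<F> (ix (of_nat k))" by (simp add: ix_of_nat)
      then show "x \<in> (\<Union>i. wedge_set R \<F> (ix i))" by blast
    qed
    show "0 < x $ i" if "x \<in> wedge_set R \<F> (ix i)" for x i
      using wedge_set_pos[OF _ that] F ix by auto
  qed blast
  show False
  proof (rule wedge_sets_not_all[OF _ tight])
    show "x \<in> wedge_set R \<F> k" if "k < 6" for k using x[of "of_nat k"] ix_of_nat that by simp
    show "0 < x $ i" for i
      using wedge_set_pos[OF _ x[of i]] F ix by auto
  qed (use F in auto)
qed

section \<open>Compactness and arbitrary families\<close>

text \<open>The triples of norm 1 form a compact space; (0, 0, 1) and (0, 0, -1) are the line at infinity.\<close>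

definition homog_line :: "(real^2) \<times> real \<Rightarrow> real^2 \<Rightarrow> real" where
  "homog_line l p = fst l \<bullet> p - snd l"

lemma zero_set_homog_line:
  assumes "norm l = 1"
  obtains L where "is_line L" "\<And>p. homog_line l p = 0 \<Longrightarrow> p \<in> L"
proof (cases "fst l = 0")
  case True
  then have "snd l \<noteq> 0" using assms by (auto simp: norm_prod_def)
  then have "homog_line l p \<noteq> 0" for p using True by (simp add: homog_line_def)
  moreover have "is_line {p. axis 1 1 \<bullet> p = (0::real)}"
    by (simp add: is_line_def affine_hyperplane axis_eq_0_iff)
  ultimately show thesis using that by blast
next
  case False
  have "is_line {p. fst l \<bullet> p = snd l}"
    using False by (simp add: is_line_def affine_hyperplane)
  then show thesis using that by (simp add: homog_line_def)
qed

text \<open>Scaling the coefficients to norm 1 keeps the zero set and places the line in a compact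
  space independent of \<open>R\<close>, which varies with the finite subfamily.\<close>

lemma homog_line_of_arc_chord:
  "\<exists>l. norm l = 1 \<and> (\<forall>p. arc_chord R x k p = 0 \<longrightarrow> homog_line l p = 0)"
proof -
  obtain n c where n: "norm n = 1" and *: "\<And>p. arc_chord R x k p = n \<bullet> p - c"
    using arc_chord_inner by metis
  have "(n, c) \<noteq> 0" using n by (auto simp: zero_prod_def)
  then have "norm (sgn (n, c)) = 1" by (simp add: norm_sgn)
  moreover have "homog_line (sgn (n, c)) p = (n \<bullet> p - c) / norm (n, c)" for p
    by (simp add: homog_line_def sgn_div_norm diff_divide_distrib divide_inverse_commute right_diff_distrib)
  ultimately show ?thesis using * by (intro exI[of _ "sgn (n, c)"]) simp
qed

theorem mainTheorem3:
  fixes \<F> :: "(real^2) set set"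
  assumes "\<And>A. A \<in> \<F> \<Longrightarrow> A \<noteq> {} \<and> compact A \<and> connected A"
    and "\<And>A B C. A \<in> \<F> \<Longrightarrow> B \<in> \<F> \<Longrightarrow> C \<in> \<F> \<Longrightarrow>
           A \<noteq> B \<Longrightarrow> A \<noteq> C \<Longrightarrow> B \<noteq> C \<Longrightarrow> tight_triple A B C"
  shows "line_piercing_number \<F> \<le> 3 \<and>
         (\<exists>l1 l2 l3. is_line l1 \<and> is_line l2 \<and> is_line l3 \<and>
            (\<forall>A\<in>\<F>. A \<inter> (l1 \<union> l2 \<union> l3) \<noteq> {}))"
proof -
  have tight: "tight_triple A B C" if "A \<in> \<F>" "B \<in> \<F>" "C \<in> \<F>" for A B C
    using assms that tight_triple_if_eq by metis
  define T where "T = sphere (0 :: (real^2) \<times> real) 1 \<times> sphere (0 :: (real^2) \<times> real) 1 \<times> sphere (0 :: (real^2) \<times> real) 1"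
  \<comment> \<open>The product vanishes iff \<open>p\<close> is on one of the three lines; the
    absolute value turns this into \<open>h \<le> 0\<close>, the form needed for the compact
    projection.\<close>
  define h where "h = (\<lambda>((l, l', l''), p). \<bar>homog_line l p * homog_line l' p * homog_line l'' p\<bar>)"
  define K where "K A = {z \<in> T. \<exists>p\<in>A. h (z, p) \<le> 0}" for A
  have "compact T" unfolding T_def by (intro compact_Times compact_sphere)
  moreover have "continuous_on U h" for U
    unfolding h_def homog_line_def case_prod_beta by (intro continuous_intros)
  ultimately have cK: "compact (K A)" if "A \<in> \<F>" for A
    unfolding K_def using assms(1) that by (intro compact_projection_le_zero) auto
  have fip: "T \<inter> \<Inter> (K ` \<G>) \<noteq> {}" if \<G>: "finite \<G>" "\<G> \<subseteq> \<F>" for \<G>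
  proof -
    have "bounded (\<Union>\<G>)" using \<G> assms(1) by (intro bounded_Union) (auto intro: compact_imp_bounded)
    then obtain R where "\<Union>\<G> \<subseteq> cball 0 R" by (auto simp: bounded_iff subset_iff)
    then have "\<exists>x. \<forall>F\<in>\<G>. \<exists>p\<in>F. \<exists>k<3. arc_chord R x k p = 0"
      using \<G> assms(1) tight by (intro bounded_family_pierced) blast+
    then obtain x where x: "\<And>F. F \<in> \<G> \<Longrightarrow> \<exists>p\<in>F. \<exists>k<3. arc_chord R x k p = 0"
      by blast
    obtain l where l: "\<And>k. norm (l k) = 1" "\<And>k p. arc_chord R x k p = 0 \<Longrightarrow> homog_line (l k) p = 0"
      using homog_line_of_arc_chord[of R x] by metis
    have "(l 0, l 1, l 2) \<in> K F" if "F \<in> \<G>" for F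
    proof -
      obtain p k where "p \<in> F" "k < 3" "arc_chord R x k p = 0" using x[OF \<open>F \<in> \<G>\<close>] by blast
      moreover have "k = 0 \<or> k = 1 \<or> k = 2" using \<open>k < 3\<close> by linarith
      ultimately show ?thesis using l by (auto simp: K_def T_def h_def intro!: bexI[of _ p])
    qed
    moreover have "(l 0, l 1, l 2) \<in> T" using l by (simp add: T_def)
    ultimately show ?thesis by blast
  qed
  have "T \<inter> \<Inter> (K ` \<F>) \<noteq> {}"
  proof (rule compact_imp_fip)
    show "T \<inter> \<Inter> \<C> \<noteq> {}" if "finite \<C>" "\<C> \<subseteq> K ` \<F>" for \<C>
      using fip finite_subset_image[OF that] by blast
  qed (use \<open>compact T\<close> cK compact_imp_closed in auto)
  then obtain z where z: "z \<in> T" "\<And>A. A \<in> \<F> \<Longrightarrow> z \<in> K A" by blast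
  obtain a b c where "z = (a, b, c)" by (metis prod_cases3)
  with z have "(a, b, c) \<in> T" and abc: "\<And>A. A \<in> \<F> \<Longrightarrow> (a, b, c) \<in> K A" by auto
  then have "norm a = 1" "norm b = 1" "norm c = 1" by (auto simp: T_def)
  then obtain l1 l2 l3 where lines: "is_line l1" "is_line l2" "is_line l3"
    and "\<And>p. homog_line a p = 0 \<Longrightarrow> p \<in> l1" "\<And>p. homog_line b p = 0 \<Longrightarrow> p \<in> l2"
      "\<And>p. homog_line c p = 0 \<Longrightarrow> p \<in> l3"
    by (metis zero_set_homog_line)
  with abc have hit: "A \<inter> (l1 \<union> l2 \<union> l3) \<noteq> {}" if "A \<in> \<F>" for A
    using that by (fastforce simp: K_def h_def)
  \<comment> \<open>The three lines may coincide, so the number of lines used is the cardinality of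
    the set, at most 3.\<close>
  have "pierced_by_lines (card {l1, l2, l3}) \<F>"
    unfolding pierced_by_lines_def using lines hit by (intro exI[of _ "{l1, l2, l3}"]) (auto simp: Un_assoc)
  then have "line_piercing_number \<F> \<le> enat (card {l1, l2, l3})"
    unfolding line_piercing_number_def by (intro Inf_lower) blast
  also have "\<dots> \<le> enat 3" by (simp add: card_insert_if)
  finally have "line_piercing_number \<F> \<le> 3" by (simp add: numeral_eq_enat)
  then show ?thesis using lines hit by blast
qed

end
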